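(* For $n=5$ and $n=6$, the integer $n$ is non-MC and its LUBOR is $R_n=\sqrt{10}/2$. That is, there is no $n$-enclosing circle of largest radius, and the least upper bound of the radii of all $n$-enclosing circles is $\sqrt{10}/2$.
   Context: A lattice point is a point of the $xy$-plane with integer coordinates. A circle is the 1-dimensional boundary of a disk of positive radius. A circle encloses a point if the point lies in the open disk bounded by the circle (points on the circumference are not enclosed). For a nonnegative integer $n$, a circle (with arbitrary real center) is $n$-enclosing if it encloses exactly $n$ lattice points. A nonnegative integer $n$ is MC (maximally circlable) if among all $n$-enclosing circles there is one of largest radius. Otherwise $n$ is non-MC, and the LUBOR of $n$, denoted $R_n$, is the least upper bound of the radii of all $n$-enclosing circles. *)

theory Defs
  imports "HOL-Analysis.Analysis"
begin

text \<open>The plane is \<^typ>\<open>real \<times> real\<close>, whose library metric is the Euclidean one. A circle is given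
  by its centre \<open>c\<close> and radius \<open>r > 0\<close>; the open disk it bounds is \<open>ball c r\<close>.\<close>

definition lattice_points :: "(real \<times> real) set" where
  "lattice_points = \<int> \<times> \<int>"

definition enclosed_points :: "real \<times> real \<Rightarrow> real \<Rightarrow> (real \<times> real) set" where
  "enclosed_points c r = lattice_points \<inter> ball c r"

text \<open>The finiteness conjunct is there because \<^const>\<open>card\<close> is \<open>0\<close> on infinite sets.\<close>

definition n_enclosing :: "nat \<Rightarrow> real \<times> real \<Rightarrow> real \<Rightarrow> bool" where
  "n_enclosing n c r \<longleftrightarrow>
     r > 0 \<and> finite (enclosed_points c r) \<and> card (enclosed_points c r) = n"

definition enclosing_radii :: "nat \<Rightarrow> real set" where
  "enclosing_radii n = {r. \<exists>c. n_enclosing n c r}"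

definition MC :: "nat \<Rightarrow> bool" where
  "MC n \<longleftrightarrow> (\<exists>c r. n_enclosing n c r \<and> (\<forall>c' r'. n_enclosing n c' r' \<longrightarrow> r' \<le> r))"

text \<open>A real supremum is the least upper bound only for a nonempty set that is bounded above, so a
  statement about the value of \<open>LUBOR n\<close> should be accompanied by these two properties of
  \<^term>\<open>enclosing_radii n\<close>.\<close>

definition LUBOR :: "nat \<Rightarrow> real" where
  "LUBOR n = Sup (enclosing_radii n)"

end

theory Submission
  imports Defs
begin

text \<open>Put the origin at the centre of a unit cell. The twelve lattice points nearest to it are four at
  squared distance \<open>1/2\<close> and eight at squared distance \<open>5/2\<close>. A disk of squared radius at least
  \<open>5/2\<close> therefore contains just the four points if it is centred there with squared radius exactly
  \<open>5/2\<close>. As soon as the centre moves, by symmetry to a point \<open>(x, y)\<close> with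
  \<open>0 \<le> y \<le> x \<le> 1/2\<close> and \<open>x > 0\<close>, the disk also swallows
  \<open>(3/2, 1/2)\<close>, \<open>(3/2, -1/2)\<close> and \<open>(1/2, 3/2)\<close>, so it never contains exactly five or six points.
  Conversely, moving the centre by \<open>(3d, d)\<close> puts these three points at squared distances
  \<open>5/2 - 10d + 10d\<^sup>2\<close>, \<open>5/2 - 8d + 10d\<^sup>2\<close> and \<open>5/2 - 6d + 10d\<^sup>2\<close>;
  the last two values, as squared radii, give disks with exactly five and six points.\<close>

lemma Pair_mem_enclosed_points:
  "(u, v) \<in> enclosed_points (x, y) r \<longleftrightarrow> u \<in> \<int> \<and> v \<in> \<int> \<and> (u - x)\<^sup>2 + (v - y)\<^sup>2 < r\<^sup>2"
  if "r > 0"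
proof -
  have "dist (x, y) (u, v) < r \<longleftrightarrow> (u - x)\<^sup>2 + (v - y)\<^sup>2 < r\<^sup>2"
    using that real_sqrt_less_iff[of "(u - x)\<^sup>2 + (v - y)\<^sup>2" "r\<^sup>2"]
    by (simp add: dist_Pair_Pair dist_real_def power2_commute)
  then show ?thesis
    by (simp add: enclosed_points_def lattice_points_def)
qed

lemma n_enclosing_isometry:
  assumes "bij f" "\<And>p q. dist (f p) (f q) = dist p q"
    and "\<And>p. f p \<in> lattice_points \<longleftrightarrow> p \<in> lattice_points"
  shows "n_enclosing n (f c) r \<longleftrightarrow> n_enclosing n c r"
proof -
  have inj: "inj_on f A" for A
    using assms(1) by (meson bij_def inj_on_subset subset_UNIV)
  have "enclosed_points (f c) r = f ` enclosed_points c r"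
  proof (rule set_eqI)
    fix q
    obtain p where "q = f p"
      using assms(1) by (meson bij_pointE)
    then show "q \<in> enclosed_points (f c) r \<longleftrightarrow> q \<in> f ` enclosed_points c r"
      using assms(2,3) inj_image_mem_iff[OF inj] by (simp add: enclosed_points_def)
  qed
  then show ?thesis
    by (simp add: n_enclosing_def card_image[OF inj] finite_image_iff[OF inj])
qed

lemma n_enclosing_swap: "n_enclosing n (y, x) r \<longleftrightarrow> n_enclosing n (x, y) r"
proof -
  have "n_enclosing n (prod.swap (x, y)) r \<longleftrightarrow> n_enclosing n (x, y) r"
    by (rule n_enclosing_isometry)
      (auto simp: dist_prod_def lattice_points_def add.commute intro: bij_swap)
  then show ?thesis
    by simp
qed

text \<open>Treating one coordinate suffices: \<open>n_enclosing_swap\<close> carries the result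
  over to the other.\<close>

lemma n_enclosing_fst_isometry:
  assumes "s = 1 \<or> s = -1" "m \<in> \<int>"
  shows "n_enclosing n (s * x + m, y) r \<longleftrightarrow> n_enclosing n (x, y) r"
proof -
  define f where "f = (\<lambda>p :: real \<times> real. (s * fst p + m, snd p))"
  have "n_enclosing n (f (x, y)) r \<longleftrightarrow> n_enclosing n (x, y) r"
  proof (rule n_enclosing_isometry)
    show "bij f"
      by (rule o_bij[of "\<lambda>p. (s * (fst p - m), snd p)"]) (use assms(1) in \<open>auto simp: f_def\<close>)
    show "dist (f p) (f q) = dist p q" for p q
      using assms(1) by (auto simp: f_def dist_prod_def dist_real_def power2_commute)
    show "f p \<in> lattice_points \<longleftrightarrow> p \<in> lattice_points" for p
      using assms by (cases p) (auto simp: f_def lattice_points_def)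
  qed
  then show ?thesis
    by (simp add: f_def)
qed

lemma fold_into_half_unit:
  fixes x :: real
  obtains s m where "s = 1 \<or> s = -1" "m \<in> \<int>" "1/2 \<le> s * x + m" "s * x + m \<le> 1"
proof (cases "1/2 \<le> frac x")
  case True
  then show ?thesis
    using that[of 1 "- of_int \<lfloor>x\<rfloor>"] frac_lt_1[of x] by (simp add: frac_def)
next
  case False
  then show ?thesis
    using that[of "-1" "of_int \<lfloor>x\<rfloor> + 1"] frac_ge_0[of x] by (simp add: frac_def)
qed

text \<open>Reduces an arbitrary centre to a fundamental triangle of the symmetry group of the
  lattice. The unit cell is now [0,1] x [0,1], with its centre at (1/2, 1/2).\<close>

lemma n_enclosing_fold:
  assumes "n_enclosing n c r"
  obtains x y where "n_enclosing n (x, y) r" "1/2 \<le> y" "y \<le> x" "x \<le> 1"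
proof -
  obtain a b where c: "c = (a, b)"
    by (cases c)
  obtain s m where s: "s = 1 \<or> s = -1" "m \<in> \<int>" "1/2 \<le> s * a + m" "s * a + m \<le> 1"
    by (rule fold_into_half_unit)
  obtain t k where t: "t = 1 \<or> t = -1" "k \<in> \<int>" "1/2 \<le> t * b + k" "t * b + k \<le> 1"
    by (rule fold_into_half_unit)
  have "n_enclosing n (b, s * a + m) r"
    using assms unfolding c by (simp add: n_enclosing_swap[of n b] n_enclosing_fst_isometry[OF s(1,2)])
  then have 1: "n_enclosing n (t * b + k, s * a + m) r"
    by (simp add: n_enclosing_fst_isometry[OF t(1,2)])
  then have 2: "n_enclosing n (s * a + m, t * b + k) r"
    by (simp add: n_enclosing_swap[of n "s * a + m"])
  show ?thesis
    using that[OF 1] that[OF 2] s t by linarith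
qed

lemma int_near_half:
  fixes u x :: real
  assumes "u \<in> \<int>" "(u - x)\<^sup>2 < 5/2" "1/2 \<le> x" "x \<le> 4/5"
  shows "u \<in> {-1, 0, 1, 2}"
proof -
  obtain i where u: "u = of_int i"
    using assms(1) by (auto elim: Ints_cases)
  \<comment> \<open>8/5 is a rational slightly above the square root of 5/2, since 64/25 >
    5/2.\<close>
  have "\<bar>u - x\<bar> < 8/5"
    by (rule power2_less_imp_less) (use assms(2) in \<open>simp_all add: power_divide\<close>)
  then have "-2 < u" "u < 3"
    using assms(3,4) by linarith+
  then have "i = -1 \<or> i = 0 \<or> i = 1 \<or> i = 2"
    unfolding u by linarith
  then show ?thesis
    unfolding u by auto
qed

text \<open>Leaves only 16 candidates, so that enclosed sets can be determined by a finite case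
  check.\<close>

lemma enclosed_points_near_cell:
  assumes "(u, v) \<in> enclosed_points (x, y) r" "r > 0" "r\<^sup>2 \<le> 5/2"
    and "x \<in> {1/2..4/5}" "y \<in> {1/2..4/5}"
  shows "u \<in> {-1, 0, 1, 2} \<and> v \<in> {-1, 0, 1, 2}"
proof -
  have h: "u \<in> \<int>" "v \<in> \<int>" "(u - x)\<^sup>2 + (v - y)\<^sup>2 < r\<^sup>2"
    using assms(1) Pair_mem_enclosed_points[OF assms(2)] by auto
  have "(u - x)\<^sup>2 < 5/2" "(v - y)\<^sup>2 < 5/2"
    using h(3) assms(3) zero_le_power2[of "u - x"] zero_le_power2[of "v - y"] by linarith+
  then show ?thesis
    using h(1,2) assms(4,5) int_near_half[of u x] int_near_half[of v y] by simp
qed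

lemma enclosed_points_centre:
  assumes "r > 0" "r\<^sup>2 = 5/2"
  shows "enclosed_points (1/2, 1/2) r = {(0,0), (0,1), (1,0), (1,1)}"
proof (rule set_eqI, clarify)
  fix u v :: real
  have "u \<in> {-1, 0, 1, 2} \<and> v \<in> {-1, 0, 1, 2}" if "(u, v) \<in> enclosed_points (1/2, 1/2) r"
    using enclosed_points_near_cell[OF that assms(1)] assms(2) by simp
  then show "(u, v) \<in> enclosed_points (1/2, 1/2) r \<longleftrightarrow> (u, v) \<in> {(0,0), (0,1), (1,0), (1,1)}"
    unfolding Pair_mem_enclosed_points[OF assms(1)] assms(2) by (auto simp: power_divide)
qed

lemma seven_enclosed:
  assumes "r > 0" "r\<^sup>2 \<ge> 5/2" "1/2 \<le> y" "y \<le> x" "x \<le> 1"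
    and "x > 1/2 \<or> r\<^sup>2 > 5/2"
  shows "{(0,0), (0,1), (1,0), (1,1), (2,0), (2,1), (1,2)} \<subseteq> enclosed_points (x, y) r"
proof -
  \<comment> \<open>By convexity the square lies below its chord on [1/2, 1]:
    \<open>x\<^sup>2 \<le> (3*x - 1)/2\<close>. This bounds squared distances by expressions linear
    in \<open>x\<close> and \<open>y\<close>.\<close>
  have "(2*x - 1) * (1 - x) \<ge> 0" "(2*y - 1) * (1 - y) \<ge> 0"
    using assms by auto
  then have bound: "(u - x)\<^sup>2 + (v - y)\<^sup>2 \<le> u\<^sup>2 + v\<^sup>2 - 1 + (3/2 - 2 * u) * x + (3/2 - 2 * v) * y" for u v
    by (simp add: power2_eq_square algebra_simps)
  \<comment> \<open>For the four corners of the cell the bound is at most 2; for the three outer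
    points it is at most 5/2, with equality only if \<open>x = 1/2\<close>.\<close>
  have "u\<^sup>2 + v\<^sup>2 - 1 + (3/2 - 2 * u) * x + (3/2 - 2 * v) * y < r\<^sup>2"
    if "(u, v) \<in> {(0,0), (0,1), (1,0), (1,1), (2,0), (2,1), (1,2)}" for u v
    using that assms(2-6) by auto
  then show ?thesis
    using assms(1) by (auto simp: Pair_mem_enclosed_points simp del: diff_0 diff_0_right
        intro!: le_less_trans[OF bound])
qed

lemma n_enclosing_large_radius:
  assumes "n_enclosing n c r" "r\<^sup>2 \<ge> 5/2"
  shows "n = 4 \<or> n \<ge> 7"
proof -
  obtain x y where xy: "n_enclosing n (x, y) r" "1/2 \<le> y" "y \<le> x" "x \<le> 1"
    using n_enclosing_fold[OF assms(1)] .
  then have r: "r > 0" and fin: "finite (enclosed_points (x, y) r)"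
    and n: "card (enclosed_points (x, y) r) = n"
    by (auto simp: n_enclosing_def)
  show ?thesis
  proof (cases "x > 1/2 \<or> r\<^sup>2 > 5/2")
    case True
    show ?thesis
      using card_mono[OF fin seven_enclosed[OF r assms(2) xy(2-4) True]] n by simp
  next
    case False
    then have c: "x = 1/2" "y = 1/2" "r\<^sup>2 = 5/2"
      using assms(2) xy by auto
    show ?thesis
      using n[unfolded c(1,2) enclosed_points_centre[OF r c(3)]] by simp
  qed
qed

text \<open>For \<open>l = 8\<close> the circle passes through (2,0), for \<open>l = 6\<close>
  through (1,2); as the disk is open, that point is just left out.\<close>

lemma enclosed_points_displaced:
  assumes "0 < d" "d \<le> 1/20" "r > 0" "r\<^sup>2 = 5/2 - l * d + 10 * d\<^sup>2" "l = 6 \<or> l = 8"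
  shows "enclosed_points (1/2 + 3*d, 1/2 + d) r =
    {(0,0), (0,1), (1,0), (1,1), (2,1)} \<union> (if l = 6 then {(2,0)} else {})"
proof (rule set_eqI, clarify)
  fix u v :: real
  let ?x = "1/2 + 3*d" and ?y = "1/2 + d"
  have d2: "d * d \<le> d / 20" "0 < d * d"
    using assms(1,2) by (auto simp: mult_left_mono)
  have r2: "r\<^sup>2 < 5/2"
    using assms(1,2,4,5) d2 by (auto simp: power2_eq_square)
  have "u \<in> {-1, 0, 1, 2} \<and> v \<in> {-1, 0, 1, 2}" if "(u, v) \<in> enclosed_points (?x, ?y) r"
    using enclosed_points_near_cell[OF that assms(3)] r2 assms(1,2) by simp
  \<comment> \<open>The terms in \<open>d\<^sup>2\<close> cancel. At each candidate
    \<open>u\<^sup>2 - u\<close> and \<open>v\<^sup>2 - v\<close> are 0 or 2; when they sum to 2,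
    the sign of the coefficient of \<open>d\<close> decides.\<close>
  moreover have "(u - ?x)\<^sup>2 + (v - ?y)\<^sup>2 < r\<^sup>2 \<longleftrightarrow>
      (u\<^sup>2 - u) + (v\<^sup>2 - v) + d * (l + 4 - 6 * u - 2 * v) < 2"
    unfolding assms(4) by (intro iffI) (simp_all add: power2_eq_square algebra_simps)
  ultimately show "(u, v) \<in> enclosed_points (?x, ?y) r \<longleftrightarrow>
    (u, v) \<in> {(0,0), (0,1), (1,0), (1,1), (2,1)} \<union> (if l = 6 then {(2,0)} else {})"
    using assms(1,2,5) unfolding Pair_mem_enclosed_points[OF assms(3)] by auto
qed

lemma n_enclosing_near_limit:
  assumes "n = 5 \<or> n = 6" "z < sqrt 10 / 2"
  obtains c r where "n_enclosing n c r" "z < r"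
proof -
  \<comment> \<open>Since \<open>z\<close> may be negative, it is cut off at 0 before squaring;
    \<open>w < r\<close> then also gives \<open>r > 0\<close>.\<close>
  define w where "w = max z 0"
  define l :: real where "l = (if n = 6 then 6 else 8)"
  \<comment> \<open>As \<open>l \<le> 8\<close>, the second argument ensures
    \<open>l * d \<le> 5/2 - w\<^sup>2\<close>, so the term \<open>10 * d\<^sup>2\<close> makes
    \<open>r\<^sup>2\<close> exceed \<open>w\<^sup>2\<close>.\<close>
  define d where "d = min (1/20) ((5/2 - w\<^sup>2) / 8)"
  define r where "r = sqrt (5/2 - l * d + 10 * d\<^sup>2)"
  have l: "l = 6 \<or> l = 8"
    by (simp add: l_def)
  have "w\<^sup>2 < (sqrt 10 / 2)\<^sup>2"
    using assms(2) by (intro power_strict_mono) (auto simp: w_def max_def)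
  then have d: "0 < d" "d \<le> 1/20" "8 * d \<le> 5/2 - w\<^sup>2"
    by (auto simp: d_def power_divide min_def)
  have "l * d \<le> 8 * d"
    using d(1) l by auto
  then have w2: "w\<^sup>2 < 5/2 - l * d + 10 * d\<^sup>2"
    using d(3) zero_less_power[OF d(1), of 2] by linarith
  then have w: "w < r"
    unfolding r_def by (rule real_less_rsqrt)
  then have r: "r > 0"
    by (simp add: w_def)
  have r2: "r\<^sup>2 = 5/2 - l * d + 10 * d\<^sup>2"
    unfolding r_def using w2 zero_le_power2[of w] by (intro real_sqrt_pow2) linarith
  have "n_enclosing n (1/2 + 3*d, 1/2 + d) r"
    using assms(1) r by (auto simp: n_enclosing_def enclosed_points_displaced[OF d(1,2) r r2 l] l_def)
  then show ?thesis
    using that w by (simp add: w_def)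
qed

theorem theorem2p4:
  fixes n :: nat
  assumes "n = 5 \<or> n = 6"
  shows "\<not> MC n
    \<and> enclosing_radii n \<noteq> {} \<and> bdd_above (enclosing_radii n)
    \<and> LUBOR n = sqrt 10 / 2"
proof -
  have upper: "r < sqrt 10 / 2" if "n_enclosing n c r" for c r
  proof (rule ccontr)
    assume "\<not> r < sqrt 10 / 2"
    then have "(sqrt 10 / 2)\<^sup>2 \<le> r\<^sup>2"
      by (intro power_mono) auto
    then show False
      using n_enclosing_large_radius[OF that] assms by (auto simp: power_divide)
  qed
  have lower: "\<exists>c r. n_enclosing n c r \<and> z < r" if "z < sqrt 10 / 2" for z
    using n_enclosing_near_limit[OF assms that] by blast
  \<comment> \<open>A largest radius would lie strictly below the bound, so \<open>lower\<close>
    applied to it yields a larger one.\<close>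
  have "\<not> MC n"
    unfolding MC_def using upper lower by (meson not_le)
  moreover have "enclosing_radii n \<noteq> {}"
    using lower[of 0] by (auto simp: enclosing_radii_def)
  moreover have "bdd_above (enclosing_radii n)"
    using upper by (auto simp: enclosing_radii_def intro!: bdd_aboveI[of _ "sqrt 10 / 2"] less_imp_le)
  moreover have "LUBOR n = sqrt 10 / 2"
    unfolding LUBOR_def
  proof (rule cSup_eq_non_empty)
    show "enclosing_radii n \<noteq> {}"
      by fact
    show "r \<le> sqrt 10 / 2" if "r \<in> enclosing_radii n" for r
      using that upper by (auto simp: enclosing_radii_def intro: less_imp_le)
    show "sqrt 10 / 2 \<le> b" if "\<And>r. r \<in> enclosing_radii n \<Longrightarrow> r \<le> b" for b
      using that lower[of b] by (force simp: enclosing_radii_def)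
  qed
  ultimately show ?thesis
    by blast
qed

end
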